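(* Let $G$ be a finite $2$-group, let $h\ge 2$ be an even integer and let $r\ge 1$ be an integer. Put $H(G)=\{x\in G : x^2=e\}$. Then $$D^*(G)\cong X_{h,r}$$ if and only if $\exp(G)=4$ and $H(G)$ is a subgroup of $G$ satisfying $|H(G)|=h$ and $[G:H(G)]=r+1$. Moreover, if $D^*(G)\cong X_{h,r}$, then the adjacency spectrum of $D^*(G)$ determines $|G|$, $r_2(G)$, $|H(G)|$ and $[G:H(G)]$; precisely, if $n=|V(D^*(G))|$ and $\rho$ is the spectral radius of the adjacency matrix of $D^*(G)$, then $$|G|=n+1,\qquad |H(G)|=n-\rho+1,\qquad r_2(G)=n-\rho,\qquad [G:H(G)]=1+\frac{\rho}{n-\rho+1}.$$
   Context: All graphs are finite, simple and undirected. A finite $2$-group is a finite group whose order is a power of $2$; $e$ is the identity, $o(x)$ the order of $x$, and $\exp(G)$ the least positive integer $m$ with $g^m=e$ for all $g\in G$. $r_2(G)$ denotes the number of involutions (elements of order $2$) of $G$. For a finite group $G$, the Proper POE Complement Graph $D^*(G)$ has vertex set $G^*=G\setminus\{e\}$, and two distinct vertices $x,y$ are adjacent if and only if $o(xy)$ is not a prime number. For an even integer $h\ge 2$ and an integer $r\ge 1$, the graph $X_{h,r}$ is the join $$X_{h,r}=\overline{K}_{h-1}\vee\left(\bigvee_{i=1}^{r}\left(\tfrac h2\right)K_2\right),$$ where $\overline{K}_{h-1}$ is the edgeless graph on $h-1$ vertices, $\left(\frac h2\right)K_2$ is the disjoint union of $\frac h2$ copies of $K_2$, and the join $\vee$ of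 pairwise vertex-disjoint graphs is obtained from their disjoint union by adding all edges between vertices of different constituents. *)

theory Defs
  imports
    "HOL-Algebra.Multiplicative_Group"
    "HOL-Computational_Algebra.Primes"
    "Graph_Theory.Graph_Theory"
    "Jordan_Normal_Form.Spectral_Radius"
begin

section \<open>Finite 2-groups\<close>

definition finite_two_group :: "('a, 'm) monoid_scheme \<Rightarrow> bool" where
  "finite_two_group G \<longleftrightarrow> group G \<and> finite (carrier G) \<and> (\<exists>k::nat. Coset.order G = 2 ^ k)"

definition group_exp :: "('a, 'm) monoid_scheme \<Rightarrow> nat" where
  "group_exp G = (LEAST m. 0 < m \<and> (\<forall>g\<in>carrier G. g [^]\<^bsub>G\<^esub> m = \<one>\<^bsub>G\<^esub>))"

definition r2 :: "('a, 'm) monoid_scheme \<Rightarrow> nat" where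
  "r2 G = card {x \<in> carrier G. group.ord G x = 2}"

definition H_set :: "('a, 'm) monoid_scheme \<Rightarrow> 'a set" where
  "H_set G = {x \<in> carrier G. x [^]\<^bsub>G\<^esub> (2::nat) = \<one>\<^bsub>G\<^esub>}"

abbreviation group_index :: "('a, 'm) monoid_scheme \<Rightarrow> 'a set \<Rightarrow> nat" where
  "group_index G H \<equiv> card (rcosets\<^bsub>G\<^esub> H)"

section \<open>Graphs\<close>

text \<open>
  A finite simple undirected graph is a \<^locale>\<open>pair_graph\<close>: the edge between \<open>u\<close> and \<open>v\<close> is
  represented by the two arcs \<open>(u, v)\<close> and \<open>(v, u)\<close>.
\<close>

abbreviation graph_iso :: "'a pair_pre_digraph \<Rightarrow> 'b pair_pre_digraph \<Rightarrow> bool" where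
  "graph_iso A B \<equiv> digraph_iso (with_proj A) (with_proj B)"

definition poe_complement_graph :: "('a, 'm) monoid_scheme \<Rightarrow> 'a pair_pre_digraph" where
  "poe_complement_graph G =
     \<lparr> pverts = carrier G - {\<one>\<^bsub>G\<^esub>},
       parcs = {(x, y). x \<in> carrier G - {\<one>\<^bsub>G\<^esub>} \<and> y \<in> carrier G - {\<one>\<^bsub>G\<^esub>} \<and> x \<noteq> y \<and>
                  \<not> prime (group.ord G (x \<otimes>\<^bsub>G\<^esub> y))} \<rparr>"

definition edgeless_graph :: "nat \<Rightarrow> nat pair_pre_digraph" where
  "edgeless_graph n = \<lparr> pverts = {..<n}, parcs = {} \<rparr>"

definition complete_graph :: "nat \<Rightarrow> nat pair_pre_digraph" where
  "complete_graph n = \<lparr> pverts = {..<n}, parcs = {(u, v). u < n \<and> v < n \<and> u \<noteq> v} \<rparr>"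

text \<open>
  Constituents are made vertex-disjoint by tagging: with their index for families, and by the
  injections into the sum type for the join of two graphs.
\<close>

definition disjoint_union_graph ::
    "'i set \<Rightarrow> ('i \<Rightarrow> 'a pair_pre_digraph) \<Rightarrow> ('i \<times> 'a) pair_pre_digraph" where
  "disjoint_union_graph I F =
     \<lparr> pverts = (SIGMA i:I. pverts (F i)),
       parcs = {((i, u), (i, v)) | i u v. i \<in> I \<and> (u, v) \<in> parcs (F i)} \<rparr>"

definition big_join ::
    "'i set \<Rightarrow> ('i \<Rightarrow> 'a pair_pre_digraph) \<Rightarrow> ('i \<times> 'a) pair_pre_digraph" where
  "big_join I F =
     \<lparr> pverts = pverts (disjoint_union_graph I F),
       parcs = parcs (disjoint_union_graph I F) \<union>
         {((i, u), (j, v)) | i j u v.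
            i \<in> I \<and> j \<in> I \<and> i \<noteq> j \<and> u \<in> pverts (F i) \<and> v \<in> pverts (F j)} \<rparr>"

definition graph_join ::
    "'a pair_pre_digraph \<Rightarrow> 'b pair_pre_digraph \<Rightarrow> ('a + 'b) pair_pre_digraph" where
  "graph_join A B =
     \<lparr> pverts = pverts A <+> pverts B,
       parcs = {(Inl u, Inl v) | u v. (u, v) \<in> parcs A} \<union>
               {(Inr u, Inr v) | u v. (u, v) \<in> parcs B} \<union>
               {(Inl u, Inr v) | u v. u \<in> pverts A \<and> v \<in> pverts B} \<union>
               {(Inr v, Inl u) | u v. u \<in> pverts A \<and> v \<in> pverts B} \<rparr>"

definition X_graph :: "nat \<Rightarrow> nat \<Rightarrow> (nat + nat \<times> nat \<times> nat) pair_pre_digraph" where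
  "X_graph h r =
     graph_join (edgeless_graph (h - 1))
       (big_join {1..r} (\<lambda>_. disjoint_union_graph {..<h div 2} (\<lambda>_. complete_graph 2)))"

section \<open>Adjacency spectrum\<close>

text \<open>
  The adjacency matrix is taken with respect to an enumeration of the vertices; different
  enumerations give permutation-similar matrices.
\<close>

definition vertex_enum :: "'a pair_pre_digraph \<Rightarrow> 'a list \<Rightarrow> bool" where
  "vertex_enum A vs \<longleftrightarrow> distinct vs \<and> set vs = pverts A"

definition adjacency_matrix :: "'a pair_pre_digraph \<Rightarrow> 'a list \<Rightarrow> complex mat" where
  "adjacency_matrix A vs =
     mat (length vs) (length vs) (\<lambda>(i, j). if (vs ! i, vs ! j) \<in> parcs A then 1 else 0)"

text \<open>Eigenvalues with algebraic multiplicity.\<close>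

definition adjacency_spectrum :: "'a pair_pre_digraph \<Rightarrow> 'a list \<Rightarrow> complex multiset" where
  "adjacency_spectrum A vs = proots (char_poly (adjacency_matrix A vs))"

section \<open>The graphs above are finite, simple and undirected\<close>

lemma pair_graphI:
  assumes "finite (pverts A)"
    and "\<And>u v. (u, v) \<in> parcs A \<Longrightarrow> u \<in> pverts A \<and> v \<in> pverts A \<and> u \<noteq> v \<and> (v, u) \<in> parcs A"
  shows "pair_graph A"
proof -
  have "parcs A \<subseteq> pverts A \<times> pverts A" using assms(2) by auto
  then have "finite (parcs A)" using assms(1) by (meson finite_SigmaI finite_subset)
  then show ?thesis
    using assms by unfold_locales (auto simp: symmetric_def sym_def)
qed

lemma pair_graphD:
  assumes "pair_graph A"
  shows "finite (pverts A)"
    and "(u, v) \<in> parcs A \<Longrightarrow> u \<in> pverts A \<and> v \<in> pverts A \<and> u \<noteq> v \<and> (v, u) \<in> parcs A"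
proof -
  interpret pair_graph A by fact
  show "finite (pverts A)" by (rule pair_finite_verts)
  show "(u, v) \<in> parcs A \<Longrightarrow> u \<in> pverts A \<and> v \<in> pverts A \<and> u \<noteq> v \<and> (v, u) \<in> parcs A"
    using in_arcsD1 in_arcsD2 pair_no_loops[of "(u, v)"] pair_sym_arcs
    by (auto simp: symmetric_def sym_def)
qed

lemma pair_graph_sym: "pair_graph A \<Longrightarrow> (u, v) \<in> parcs A \<Longrightarrow> (v, u) \<in> parcs A"
  by (simp add: pair_graphD(2))

lemma (in group) ord_mult_commute:
  assumes "x \<in> carrier G" "y \<in> carrier G"
  shows "ord (x \<otimes> y) = ord (y \<otimes> x)"
proof -
  have shift: "x \<otimes> (y \<otimes> x) [^] n = (x \<otimes> y) [^] n \<otimes> x"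
    if "x \<in> carrier G" "y \<in> carrier G" for x y and n :: nat
    using that
  proof (induction n)
    case (Suc n)
    have "x \<otimes> (y \<otimes> x) [^] Suc n = (x \<otimes> (y \<otimes> x) [^] n) \<otimes> (y \<otimes> x)"
      using Suc.prems by (simp add: m_assoc)
    also have "\<dots> = (x \<otimes> y) [^] n \<otimes> x \<otimes> (y \<otimes> x)"
      using Suc by simp
    also have "\<dots> = (x \<otimes> y) [^] Suc n \<otimes> x"
      using Suc.prems by (simp add: m_assoc)
    finally show ?case .
  qed simp
  have "(x \<otimes> y) [^] n = \<one> \<longleftrightarrow> (y \<otimes> x) [^] n = \<one>" for n :: nat
    using assms shift[of x y n]
    by (metis m_closed nat_pow_closed l_cancel_one r_cancel_one)
  then show ?thesis
    using assms by (metis m_closed pow_eq_id dvd_antisym dvd_refl)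
qed

lemma pair_graph_poe_complement_graph:
  assumes "group G" "finite (carrier G)"
  shows "pair_graph (poe_complement_graph G)"
  using assms
  by (intro pair_graphI) (auto simp: poe_complement_graph_def group.ord_mult_commute)

lemma pair_graph_edgeless_graph: "pair_graph (edgeless_graph n)"
  by (intro pair_graphI) (auto simp: edgeless_graph_def)

lemma pair_graph_complete_graph: "pair_graph (complete_graph n)"
  by (intro pair_graphI) (auto simp: complete_graph_def)

lemma pair_graph_disjoint_union_graph:
  assumes "finite I" "\<And>i. i \<in> I \<Longrightarrow> pair_graph (F i)"
  shows "pair_graph (disjoint_union_graph I F)"
  using assms(1)
  by (intro pair_graphI) (auto simp: disjoint_union_graph_def
      dest: pair_graphD(2)[OF assms(2)]
      intro: pair_graphD(1)[OF assms(2)] pair_graph_sym[OF assms(2)])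

lemma pair_graph_big_join:
  assumes "finite I" "\<And>i. i \<in> I \<Longrightarrow> pair_graph (F i)"
  shows "pair_graph (big_join I F)"
  using assms(1)
  by (intro pair_graphI) (auto simp: big_join_def disjoint_union_graph_def
      dest: pair_graphD(2)[OF assms(2)]
      intro: pair_graphD(1)[OF assms(2)] pair_graph_sym[OF assms(2)])

lemma pair_graph_graph_join:
  assumes "pair_graph A" "pair_graph B"
  shows "pair_graph (graph_join A B)"
  using assms
  by (intro pair_graphI) (auto simp: graph_join_def dest: pair_graphD intro: pair_graph_sym)

lemma pair_graph_X_graph: "pair_graph (X_graph h r)"
  unfolding X_graph_def
  by (intro pair_graph_graph_join pair_graph_big_join pair_graph_disjoint_union_graph
      pair_graph_edgeless_graph pair_graph_complete_graph) auto

end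

theory Submission
  imports Defs "HOL-Algebra.Group_Action"
begin

text \<open>
  In the complement of \<open>D\<^sup>*(G)\<close> the neighbours of \<open>x\<close> are the elements \<open>x\<^sup>-\<^sup>1t\<close>, where \<open>t\<close> is an
  involution different from \<open>x\<close> and \<open>x\<^sup>2\<close>. All vertices of \<open>X\<^sub>h\<^sub>,\<^sub>r\<close> have \<open>h - 2\<close> non-neighbours, so an
  isomorphism forces \<open>G\<close> to have \<open>h - 1\<close> involutions and every \<open>x \<noteq> e\<close> to satisfy \<open>o(x) = 2\<close> or
  \<open>o(x\<^sup>2) = 2\<close>. The number of involutions being odd, one of them, \<open>z\<close>, is central, and its
  non-neighbours are exactly the other involutions. If \<open>z\<close> corresponds to a vertex of the edgeless
  part, the involutions form a coclique, which says that \<open>H(G)\<close> is closed. Otherwise the partner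
  \<open>w\<close> of \<open>z\<close> in its copy of \<open>K\<^sub>2\<close> is the only vertex besides \<open>z\<close> and the involutions that is
  non-adjacent to an involution \<open>s \<noteq> z\<close>; as \<open>w\<^sup>-\<^sup>1\<close> has the same property, \<open>w\<close> would be an involution.

  Conversely, if \<open>H(G)\<close> is a subgroup and the exponent is 4, distinct \<open>x\<close> and \<open>y\<close> are non-adjacent
  iff they lie in the same coset of \<open>H(G)\<close> and \<open>y \<noteq> x\<^sup>-\<^sup>1\<close>. The spectral statements hold because
  \<open>D\<^sup>*(G)\<close> is regular, so that its spectral radius is its degree \<open>hr\<close>.
\<close>

section \<open>Non-neighbours and isomorphisms\<close>

text \<open>Non-adjacency is the convenient relation on both sides: in
  \<open>poe_complement_graph G\<close> it says that the product is an involution, and in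
  \<open>X_graph h r\<close> it never leaves a constituent of the join.\<close>

definition nonnbrs :: "'a pair_pre_digraph \<Rightarrow> 'a \<Rightarrow> 'a set" where
  "nonnbrs A v = {u \<in> pverts A. u \<noteq> v \<and> (v, u) \<notin> parcs A}"

text \<open>A \<open>digraph_iso\<close> has separate maps on vertices and arcs; since tail and head
  are \<open>fst\<close> and \<open>snd\<close> on both sides, the vertex map determines the arc
  map.\<close>

lemma graph_isoE:
  assumes "graph_iso A B"
  obtains f where "bij_betw f (pverts A) (pverts B)"
    and "\<And>u v. u \<in> pverts A \<Longrightarrow> v \<in> pverts A \<Longrightarrow> (u, v) \<in> parcs A \<longleftrightarrow> (f u, f v) \<in> parcs B"
proof -
  obtain g where g: "pre_digraph.digraph_isomorphism (with_proj A) g"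
      and B: "with_proj B = app_iso g (with_proj A)"
    using assms unfolding digraph_iso_def by blast
  let ?f = "iso_verts g"
  have tail: "iso_tail g = fst" and head: "iso_head g = snd"
    and verts: "pverts B = ?f ` pverts A" and arcs: "parcs B = iso_arcs g ` parcs A"
    using B by (auto simp: with_proj_def app_iso_def)
  have inj: "inj_on ?f (pverts A)"
    and ends: "\<And>a. a \<in> parcs A \<Longrightarrow> iso_arcs g a = (?f (fst a), ?f (snd a))"
    and wf: "wf_digraph (with_proj A)"
    using g tail head by (auto simp: pre_digraph.digraph_isomorphism_def prod_eq_iff)
  have "(u, v) \<in> parcs A \<longleftrightarrow> (?f u, ?f v) \<in> parcs B"
    if uv: "u \<in> pverts A" "v \<in> pverts A" for u v
  proof
    assume "(u, v) \<in> parcs A"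
    then show "(?f u, ?f v) \<in> parcs B" using ends arcs by force
  next
    assume "(?f u, ?f v) \<in> parcs B"
    then obtain a where a: "a \<in> parcs A" "?f (fst a) = ?f u" "?f (snd a) = ?f v"
      using ends arcs by force
    have "fst a \<in> pverts A" "snd a \<in> pverts A"
      using wf_digraph.tail_in_verts[OF wf, of a] wf_digraph.head_in_verts[OF wf, of a] a by auto
    then have "fst a = u" "snd a = v" using a uv inj by (auto dest: inj_onD)
    then show "(u, v) \<in> parcs A" using a(1) by auto
  qed
  with inj verts that[of ?f] show thesis by (auto simp: bij_betw_def)
qed

text \<open>Arcs of a \<open>pair_graph\<close> end in vertices, so injectivity of \<open>f\<close>
  on vertices passes to \<open>map_prod f f\<close> on arcs, and every arc of \<open>B\<close> is
  hit.\<close>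

lemma graph_isoI:
  assumes "pair_graph A" "pair_graph B" and bij: "bij_betw f (pverts A) (pverts B)"
    and edge: "\<And>u v. u \<in> pverts A \<Longrightarrow> v \<in> pverts A \<Longrightarrow>
      (u, v) \<in> parcs A \<longleftrightarrow> (f u, f v) \<in> parcs B"
  shows "graph_iso A B"
proof -
  let ?g = "\<lparr>iso_verts = f, iso_arcs = map_prod f f, iso_head = snd, iso_tail = fst\<rparr>"
  interpret A: pair_graph A by fact
  note D = pair_graphD(2)[OF \<open>pair_graph A\<close>] pair_graphD(2)[OF \<open>pair_graph B\<close>]
  have inj: "inj_on f (pverts A)" and img: "f ` pverts A = pverts B"
    using bij by (auto simp: bij_betw_def)
  have "inj_on (map_prod f f) (parcs A)"
    using inj D(1) by (intro inj_onI) (auto simp: inj_on_eq_iff)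
  then have "pre_digraph.digraph_isomorphism (with_proj A) ?g"
    using inj A.wf_digraph_axioms by (simp add: pre_digraph.digraph_isomorphism_def)
  moreover have "parcs B = map_prod f f ` parcs A"
  proof (intro equalityI subsetI)
    fix a assume a: "a \<in> parcs B"
    obtain x y where xy: "a = (x, y)" by (cases a)
    then obtain u v where uv: "u \<in> pverts A" "v \<in> pverts A" "x = f u" "y = f v"
      using a D(2) img by (metis imageE)
    then have "(u, v) \<in> parcs A" using edge a xy by auto
    then show "a \<in> map_prod f f ` parcs A" using uv xy by force
  next
    fix a assume "a \<in> map_prod f f ` parcs A"
    then show "a \<in> parcs B" using edge D(1) by auto
  qed
  ultimately show ?thesis
    using img unfolding digraph_iso_def
    by (intro exI[of _ ?g]) (simp add: with_proj_def app_iso_def)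
qed

lemma nonnbrs_image:
  assumes "bij_betw f (pverts A) (pverts B)"
    and "\<And>u v. u \<in> pverts A \<Longrightarrow> v \<in> pverts A \<Longrightarrow> (u, v) \<in> parcs A \<longleftrightarrow> (f u, f v) \<in> parcs B"
    and "v \<in> pverts A"
  shows "nonnbrs B (f v) = f ` nonnbrs A v"
proof -
  have img: "f ` pverts A = pverts B" and inj: "inj_on f (pverts A)"
    using assms(1) by (auto simp: bij_betw_def)
  show ?thesis
    unfolding nonnbrs_def img[symmetric] using assms(2,3) inj by (auto simp: inj_on_eq_iff)
qed

section \<open>The graph $X_{h,r}$\<close>

lemma pverts_X_graph:
  "pverts (X_graph h r) = {..<h - 1} <+> {1..r} \<times> {..<h div 2} \<times> {..<2}"
  by (auto simp: X_graph_def graph_join_def big_join_def disjoint_union_graph_def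
      edgeless_graph_def complete_graph_def)

lemma card_pverts_X_graph:
  assumes "even h"
  shows "card (pverts (X_graph h r)) = h - 1 + r * h"
  using assms by (simp add: pverts_X_graph card_Plus card_cartesian_product)

lemma nonnbrs_X_graph_Inl:
  assumes "i < h - 1"
  shows "nonnbrs (X_graph h r) (Inl i) = Inl ` ({..<h - 1} - {i})"
  using assms unfolding nonnbrs_def pverts_X_graph
  by (auto simp: X_graph_def graph_join_def big_join_def disjoint_union_graph_def
      edgeless_graph_def complete_graph_def)

lemma nonnbrs_X_graph_Inr:
  assumes "j \<in> {1..r}" "c < h div 2" "b < 2"
  shows "nonnbrs (X_graph h r) (Inr (j, c, b)) = (\<lambda>p. Inr (j, p)) ` (({..<h div 2} - {c}) \<times> {..<2})"
  using assms unfolding nonnbrs_def pverts_X_graph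
  by (auto simp: X_graph_def graph_join_def big_join_def disjoint_union_graph_def
      edgeless_graph_def complete_graph_def)

lemma X_graph_vertex_cases:
  assumes "v \<in> pverts (X_graph h r)"
  obtains (Inl) i where "v = Inl i" "i < h - 1"
    | (Inr) j c b where "v = Inr (j, c, b)" "j \<in> {1..r}" "c < h div 2" "b < 2"
  using assms unfolding pverts_X_graph by blast

text \<open>Both kinds of vertices give the same number: \<open>h - 1\<close> less the vertex
  itself, or the other \<open>h div 2 - 1\<close> copies of \<open>K_2\<close> with two vertices
  each. Thus the graph is regular.\<close>

lemma card_nonnbrs_X_graph:
  assumes "even h" "v \<in> pverts (X_graph h r)"
  shows "card (nonnbrs (X_graph h r) v) = h - 2"
  using assms(2)
proof (cases rule: X_graph_vertex_cases)
  case (Inl i)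
  then show ?thesis by (simp add: nonnbrs_X_graph_Inl card_image)
next
  case (Inr j c b)
  then have "card (nonnbrs (X_graph h r) v) = (h div 2 - 1) * 2"
    by (simp add: nonnbrs_X_graph_Inr card_image inj_on_def card_cartesian_product)
  then show ?thesis using \<open>even h\<close> by (simp add: algebra_simps)
qed

text \<open>The first alternative holds for the edgeless part; in the second, \<open>w\<close> is the partner of \<open>v\<close> in its copy of \<open>K\<^sub>2\<close>.\<close>

lemma nonnbrs_X_graph_structure:
  assumes "v \<in> pverts (X_graph h r)"
  shows "(\<forall>u \<in> nonnbrs (X_graph h r) v. nonnbrs (X_graph h r) u - {v} = nonnbrs (X_graph h r) v - {u})
    \<or> (\<exists>w. w \<noteq> v \<and> w \<notin> nonnbrs (X_graph h r) v \<and> w \<in> pverts (X_graph h r) \<and>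
        (\<forall>u \<in> nonnbrs (X_graph h r) v. w \<in> nonnbrs (X_graph h r) u \<and>
           nonnbrs (X_graph h r) u \<subseteq> insert v (insert w (nonnbrs (X_graph h r) v))))"
  using assms
proof (cases rule: X_graph_vertex_cases)
  case (Inl i)
  then show ?thesis by (intro disjI1) (auto simp: nonnbrs_X_graph_Inl)
next
  case (Inr j c b)
  let ?w = "Inr (j, c, 1 - b)"
  have "?w \<in> pverts (X_graph h r)" using Inr by (auto simp: pverts_X_graph)
  moreover have "1 - b \<noteq> b" by arith
  then have "?w \<noteq> v" "?w \<notin> nonnbrs (X_graph h r) v"
    using Inr by (auto simp: nonnbrs_X_graph_Inr)
  moreover have "?w \<in> nonnbrs (X_graph h r) u \<and>
      nonnbrs (X_graph h r) u \<subseteq> insert v (insert ?w (nonnbrs (X_graph h r) v))"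
    if u: "u \<in> nonnbrs (X_graph h r) v" for u
  proof -
    obtain c' b' where c': "u = Inr (j, c', b')" "c' < h div 2" "c' \<noteq> c" "b' < 2"
      using u Inr by (auto simp: nonnbrs_X_graph_Inr)
    have "b'' = b \<or> b'' = 1 - b" if "b'' < 2" for b'' using that \<open>b < 2\<close> by arith
    then show ?thesis
      using c' Inr by (auto simp: nonnbrs_X_graph_Inr)
  qed
  ultimately show ?thesis by blast
qed

text \<open>A recognition criterion: \<open>S\<close> plays the edgeless part, the fibres of
  \<open>cls\<close> off \<open>S\<close> play the other \<open>r\<close> constituents, and the
  pairs \<open>{x, \<sigma> x}\<close> play the copies of \<open>K_2\<close>. Any enumerations of
  \<open>S\<close>, of the classes, of the pairs in a class and of the two points of a pair yield an
  isomorphism, because off \<open>S\<close> non-adjacency depends only on class and pair.\<close>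

lemma graph_iso_X_graphI:
  fixes A :: "'a pair_pre_digraph" and cls :: "'a \<Rightarrow> 'c"
  assumes A: "pair_graph A" and "even h"
    and S: "S \<subseteq> pverts A" "card S = h - 1" and card: "card (pverts A) = h - 1 + r * h"
    and cls: "card (cls ` (pverts A - S)) = r"
    and fibre: "\<And>x. x \<in> pverts A - S \<Longrightarrow> card {y \<in> pverts A - S. cls y = cls x} = h"
    and \<sigma>: "\<And>x. x \<in> pverts A - S \<Longrightarrow> \<sigma> x \<in> pverts A - S \<and> \<sigma> x \<noteq> x \<and> \<sigma> (\<sigma> x) = x \<and> cls (\<sigma> x) = cls x"
    and nonnbrs_S: "\<And>x. x \<in> S \<Longrightarrow> nonnbrs A x = S - {x}"
    and nonnbrs: "\<And>x. x \<in> pverts A - S \<Longrightarrow>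
      nonnbrs A x = {y \<in> pverts A - S. cls y = cls x} - {x, \<sigma> x}"
  shows "graph_iso A (X_graph h r)"
proof -
  let ?V = "pverts A - S"
  have fin: "finite (pverts A)" using A by (rule pair_graphD)
  have finS: "finite S" using fin S(1) finite_subset by blast
  define pr where "pr x = {x, \<sigma> x}" for x
  define F where "F C = {y \<in> ?V. cls y = C}" for C
  have finF: "finite (F C)" for C using fin by (simp add: F_def)
  have \<sigma>V: "\<sigma> x \<in> ?V" and \<sigma>_neq: "\<sigma> x \<noteq> x" and \<sigma>\<sigma>: "\<sigma> (\<sigma> x) = x" and cls_\<sigma>: "cls (\<sigma> x) = cls x"
    if "x \<in> ?V" for x
    using \<sigma>[OF that] by blast+
  have pr_eq: "pr x = pr y \<longleftrightarrow> y = x \<or> y = \<sigma> x" if "x \<in> ?V" "y \<in> ?V" for x y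
    unfolding pr_def doubleton_eq_iff using \<sigma>\<sigma>[OF that(1)] \<sigma>\<sigma>[OF that(2)] by metis
  have card_pr: "card (pr x) = 2" if "x \<in> ?V" for x
    using \<sigma>_neq[OF that] by (simp add: pr_def)
  have card_pairs: "card (pr ` F C) = h div 2" if C: "C \<in> cls ` ?V" for C
  proof -
    have FV: "F C \<subseteq> ?V" by (auto simp: F_def)
    have U: "\<Union> (pr ` F C) = F C"
    proof (intro equalityI subsetI)
      fix y assume "y \<in> \<Union> (pr ` F C)"
      then obtain x where x: "x \<in> F C" "y = x \<or> y = \<sigma> x" unfolding pr_def by blast
      then have "x \<in> ?V" "cls x = C" unfolding F_def by blast+
      with x \<sigma>V[of x] cls_\<sigma>[of x] show "y \<in> F C" unfolding F_def by blast
    qed (auto simp: pr_def)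
    \<comment> \<open>The pairs partition the fibre into blocks of size 2, so there are
      \<open>h div 2\<close> of them.\<close>
    have "2 * card (pr ` F C) = card (\<Union> (pr ` F C))"
    proof (rule card_partition)
      show "finite (\<Union> (pr ` F C))" unfolding U by (rule finF)
      show "finite (pr ` F C)" using finF by (rule finite_imageI)
      show "card c = 2" if "c \<in> pr ` F C" for c using that FV card_pr by blast
      show "c \<inter> d = {}" if cd: "c \<in> pr ` F C" "d \<in> pr ` F C" "c \<noteq> d" for c d
      proof -
        obtain x y where xy: "x \<in> ?V" "y \<in> ?V" "c = pr x" "d = pr y" using cd FV by blast
        then have "y \<noteq> x" "y \<noteq> \<sigma> x" using cd(3) pr_eq by blast+
        moreover then have "\<sigma> y \<noteq> x" "\<sigma> y \<noteq> \<sigma> x" using xy \<sigma>\<sigma> by metis+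
        ultimately show ?thesis unfolding xy(3,4) pr_def by auto
      qed
    qed
    also note U
    also have "card (F C) = h" using C fibre unfolding F_def by blast
    finally show ?thesis by auto
  qed
  obtain s where s: "bij_betw s S {..<h - 1}"
    using ex_bij_betw_finite_nat[OF finS] S(2) by (auto simp: atLeast0LessThan)
  obtain e where e: "bij_betw e (cls ` ?V) {1..r}"
    using finite_same_card_bij[of "cls ` ?V" "{1..r}"] fin cls by auto
  \<comment> \<open>The numbering of pairs is chosen separately in each class, and that of the two
    points separately in each pair.\<close>
  have "\<exists>p. bij_betw p (pr ` F C) {..<h div 2}" if "C \<in> cls ` ?V" for C
    using card_pairs[OF that] finF by (intro finite_same_card_bij) simp_all
  then obtain p where p: "\<And>C. C \<in> cls ` ?V \<Longrightarrow> bij_betw (p C) (pr ` F C) {..<h div 2}"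
    by metis
  have "\<exists>q. bij_betw q (pr x) {..<2::nat}" if "x \<in> ?V" for x
    using card_pr[OF that] by (intro finite_same_card_bij) (simp_all add: pr_def)
  then have "\<exists>q. bij_betw q P {..<2::nat}" if "P \<in> pr ` ?V" for P
    using that by blast
  then obtain q where q: "\<And>P. P \<in> pr ` ?V \<Longrightarrow> bij_betw (q P) P {..<2::nat}"
    by metis
  define f where "f x = (if x \<in> S then Inl (s x) else Inr (e (cls x), p (cls x) (pr x), q (pr x) x))" for x
  have e_eq: "e (cls x) = e (cls y) \<longleftrightarrow> cls x = cls y" if "x \<in> ?V" "y \<in> ?V" for x y
    using that e by (auto simp: bij_betw_def inj_on_eq_iff)
  have p_eq: "p (cls x) (pr x) = p (cls x) (pr y) \<longleftrightarrow> pr x = pr y"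
    if "x \<in> ?V" "y \<in> ?V" "cls x = cls y" for x y
  proof -
    have "pr x \<in> pr ` F (cls x)" "pr y \<in> pr ` F (cls x)" using that by (auto simp: F_def)
    with p[of "cls x"] that(1) show ?thesis by (metis bij_betw_imp_inj_on image_eqI inj_on_eq_iff)
  qed
  have q_eq: "q (pr x) x = q (pr x) y \<longleftrightarrow> x = y" if "x \<in> ?V" "y \<in> ?V" "pr x = pr y" for x y
  proof -
    have "x \<in> pr x" "y \<in> pr x" using that(3) by (auto simp: pr_def)
    with q[of "pr x"] that(1) show ?thesis by (metis bij_betw_imp_inj_on image_eqI inj_on_eq_iff)
  qed
  have ran: "e (cls x) \<in> {1..r} \<and> p (cls x) (pr x) < h div 2 \<and> q (pr x) x < 2"
    if x: "x \<in> ?V" for x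
  proof -
    have "pr x \<in> pr ` F (cls x)" "x \<in> pr x" using x by (auto simp: F_def pr_def)
    then have "p (cls x) (pr x) \<in> {..<h div 2}" "q (pr x) x \<in> {..<2}" "e (cls x) \<in> {1..r}"
      using p[of "cls x"] q[of "pr x"] e x by (auto dest: bij_betwE)
    then show ?thesis by auto
  qed
  have sran: "s x < h - 1" if "x \<in> S" for x using s that by (auto dest: bij_betwE)
  have s_eq: "s x = s y \<longleftrightarrow> x = y" if "x \<in> S" "y \<in> S" for x y
    using that s by (auto simp: bij_betw_def inj_on_eq_iff)
  have inj: "inj_on f (pverts A)"
  proof (rule inj_onI)
    fix x y assume xy: "x \<in> pverts A" "y \<in> pverts A" "f x = f y"
    show "x = y"
    proof (cases "x \<in> S \<or> y \<in> S")
      case True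
      then show ?thesis using xy s_eq by (auto simp: f_def split: if_splits)
    next
      case False
      then have V: "x \<in> ?V" "y \<in> ?V" using xy by auto
      have c: "cls x = cls y" using xy False V e_eq by (simp add: f_def)
      then have pe: "pr x = pr y" using xy False V p_eq[OF V] by (simp add: f_def)
      then show ?thesis using xy False V q_eq[OF V] by (simp add: f_def)
    qed
  qed
  have "f ` pverts A \<subseteq> pverts (X_graph h r)"
  proof (rule image_subsetI)
    fix x assume "x \<in> pverts A"
    then show "f x \<in> pverts (X_graph h r)"
      using ran[of x] sran[of x] unfolding pverts_X_graph f_def by auto
  qed
  \<comment> \<open>Surjectivity comes from counting: \<open>f\<close> is injective into a finite
    set of the same size.\<close>
  moreover have "card (f ` pverts A) = card (pverts (X_graph h r))"
    using card_image[OF inj] card card_pverts_X_graph[OF \<open>even h\<close>] by simp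
  moreover have "finite (pverts (X_graph h r))"
    by (rule pair_graphD(1)[OF pair_graph_X_graph])
  ultimately have bij: "bij_betw f (pverts A) (pverts (X_graph h r))"
    using inj by (simp add: bij_betw_def card_subset_eq)
  have "(u, v) \<in> parcs A \<longleftrightarrow> (f u, f v) \<in> parcs (X_graph h r)"
    if uv: "u \<in> pverts A" "v \<in> pverts A" for u v
  proof (cases "u = v")
    case True
    then show ?thesis
      using pair_graphD(2)[OF A] pair_graphD(2)[OF pair_graph_X_graph] by blast
  next
    case False
    have fuv: "f u \<noteq> f v" "f v \<in> pverts (X_graph h r)"
      using False inj uv bij by (auto simp: inj_on_eq_iff dest: bij_betwE)
    have "v \<in> nonnbrs A u \<longleftrightarrow> f v \<in> nonnbrs (X_graph h r) (f u)"
    proof (cases "u \<in> S")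
      case True
      then show ?thesis
        using nonnbrs_S[OF True] False sran[of u] sran[of v] s_eq[of u v]
        by (auto simp: f_def nonnbrs_X_graph_Inl)
    next
      case u: False
      then have uV: "u \<in> ?V" using uv by simp
      note r = ran[OF uV]
      have N: "nonnbrs (X_graph h r) (f u) =
        (\<lambda>p. Inr (e (cls u), p)) ` (({..<h div 2} - {p (cls u) (pr u)}) \<times> {..<2})"
        using u r by (simp add: f_def nonnbrs_X_graph_Inr)
      show ?thesis
      proof (cases "v \<in> S")
        case True
        then show ?thesis unfolding N nonnbrs[OF uV] by (auto simp: f_def)
      next
        case v: False
        then have vV: "v \<in> ?V" using uv by simp
        \<comment> \<open>The last coordinate, given by \<open>q\<close>, drops out: points of one
          pair are adjacent, and points of different pairs in one class are not, whatever their
          positions.\<close>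
        have "f v \<in> nonnbrs (X_graph h r) (f u) \<longleftrightarrow>
            cls v = cls u \<and> p (cls v) (pr v) \<noteq> p (cls u) (pr u)"
          unfolding N using v ran[OF vV] e_eq[OF vV uV] by (auto simp: f_def)
        also have "\<dots> \<longleftrightarrow> cls v = cls u \<and> pr v \<noteq> pr u"
          using p_eq[OF uV vV] by auto
        also have "\<dots> \<longleftrightarrow> v \<in> nonnbrs A u"
          unfolding nonnbrs[OF uV] using pr_eq[OF uV vV] vV False by auto
        finally show ?thesis by simp
      qed
    qed
    then show ?thesis using False uv fuv unfolding nonnbrs_def by auto
  qed
  with A pair_graph_X_graph bij show ?thesis by (rule graph_isoI)
qed

section \<open>Spectra of regular graphs\<close>

text \<open>The all-ones vector is an eigenvector for \<open>k\<close>, and the absolute row sums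
  bound every eigenvalue in modulus. For 0-1 matrices the two row conditions amount to the
  same.\<close>

lemma spectral_radius_eqI:
  fixes A :: "complex mat" and k :: real
  assumes A: "A \<in> carrier_mat n n" and "0 < n" and "0 \<le> k"
    and rows: "\<And>i. i < n \<Longrightarrow> (\<Sum>j<n. A $$ (i, j)) = of_real k"
    and abs_rows: "\<And>i. i < n \<Longrightarrow> (\<Sum>j<n. norm (A $$ (i, j))) = k"
  shows "spectral_radius A = k"
proof (rule antisym)
  have mult: "(A *\<^sub>v v) $ i = (\<Sum>j<n. A $$ (i, j) * v $ j)"
    if "v \<in> carrier_vec n" "i < n" for v i
    using that A by (auto simp: scalar_prod_def atLeast0LessThan intro!: sum.cong)
  let ?v = "vec n (\<lambda>_. 1 :: complex)"
  have "A *\<^sub>v ?v = of_real k \<cdot>\<^sub>v ?v"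
  proof (rule eq_vecI)
    fix i assume "i < dim_vec (of_real k \<cdot>\<^sub>v ?v)"
    then have i: "i < n" by simp
    have "(A *\<^sub>v ?v) $ i = (\<Sum>j<n. A $$ (i, j))"
      using i by (subst mult) simp_all
    then show "(A *\<^sub>v ?v) $ i = (of_real k \<cdot>\<^sub>v ?v) $ i"
      using rows[OF i] i by simp
  qed (use A in simp)
  moreover have "?v \<noteq> 0\<^sub>v n"
  proof
    assume "?v = 0\<^sub>v n"
    then have "?v $ 0 = 0\<^sub>v n $ 0" by simp
    with \<open>0 < n\<close> show False by simp
  qed
  ultimately have "of_real k \<in> spectrum A"
    using A unfolding spectrum_def eigenvalue_def eigenvector_def
    by (auto intro!: exI[of _ ?v])
  then have "norm (of_real k :: complex) \<in> norm ` spectrum A" by (rule imageI)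
  then show "k \<le> spectral_radius A"
    using spectral_radius_mem_max(2)[OF A \<open>0 < n\<close>] \<open>0 \<le> k\<close> by fastforce
next
  obtain l where l: "l \<in> spectrum A" "spectral_radius A = norm l"
    using spectral_radius_mem_max(1)[OF A \<open>0 < n\<close>] by auto
  then obtain v where v: "v \<in> carrier_vec n" "v \<noteq> 0\<^sub>v n" "A *\<^sub>v v = l \<cdot>\<^sub>v v"
    using A unfolding spectrum_def eigenvalue_def eigenvector_def by auto
  \<comment> \<open>Compare the moduli of the two sides of the eigenvalue equation at an entry of maximal modulus.\<close>
  define M where "M = Max ((\<lambda>j. norm (v $ j)) ` {..<n})"
  have "M \<in> (\<lambda>j. norm (v $ j)) ` {..<n}"
    unfolding M_def using \<open>0 < n\<close> by (intro Max_in) auto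
  then obtain i where i: "i < n" "M = norm (v $ i)" by auto
  have M: "norm (v $ j) \<le> M" if "j < n" for j
    unfolding M_def using that by (intro Max_ge) auto
  have "0 < M"
  proof -
    obtain j where "j < n" "v $ j \<noteq> 0" using v(1,2) by (metis eq_vecI carrier_vecD index_zero_vec)
    then show ?thesis using M[of j] by (meson less_le_trans zero_less_norm_iff)
  qed
  have "norm l * M = norm ((A *\<^sub>v v) $ i)"
    using v i by (simp add: norm_mult)
  also have "\<dots> = norm (\<Sum>j<n. A $$ (i, j) * v $ j)"
    using A v(1) i(1) by (auto simp: scalar_prod_def atLeast0LessThan intro!: arg_cong[of _ _ norm] sum.cong)
  also have "\<dots> \<le> (\<Sum>j<n. norm (A $$ (i, j)) * M)"
    using M by (intro sum_norm_le) (auto simp: norm_mult intro!: mult_left_mono)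
  also have "\<dots> = k * M"
    using abs_rows[OF i(1)] by (simp flip: sum_distrib_right)
  finally show "spectral_radius A \<le> k" using l(2) \<open>0 < M\<close> by simp
qed

lemma adjacency_matrix_carrier: "adjacency_matrix A vs \<in> carrier_mat (length vs) (length vs)"
  by (simp add: adjacency_matrix_def)

lemma length_vertex_enum: "vertex_enum A vs \<Longrightarrow> length vs = card (pverts A)"
  by (metis distinct_card vertex_enum_def)

lemma spectral_radius_regular:
  assumes A: "pair_graph A" and vs: "vertex_enum A vs" and "pverts A \<noteq> {}"
    and m: "\<And>v. v \<in> pverts A \<Longrightarrow> card (nonnbrs A v) = m"
  shows "spectral_radius (adjacency_matrix A vs) = real (card (pverts A)) - 1 - real m"
proof -
  let ?n = "length vs"
  have n: "?n = card (pverts A)" by (rule length_vertex_enum[OF vs])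
  have fin: "finite (pverts A)" using A by (rule pair_graphD)
  have set: "set vs = pverts A" and dist: "distinct vs" using vs by (auto simp: vertex_enum_def)
  have head: "u \<in> pverts A" if "(v, u) \<in> parcs A" for u v
    using pair_graphD(2)[OF A that] by simp
  have loop: "(v, v) \<notin> parcs A" for v
    using pair_graphD(2)[OF A] by blast
  \<comment> \<open>Stated over an arbitrary \<open>semiring_1\<close>, since it serves both the
    complex entries and their real norms.\<close>
  have deg: "(\<Sum>j<?n. if (vs ! i, vs ! j) \<in> parcs A then 1 else 0 :: 'z :: semiring_1)
      = of_nat (card {u. (vs ! i, u) \<in> parcs A})" for i
  proof -
    let ?J = "{j \<in> {..<?n}. (vs ! i, vs ! j) \<in> parcs A}"
    have img: "(!) vs ` ?J = {u. (vs ! i, u) \<in> parcs A}"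
    proof (intro equalityI subsetI)
      fix u assume "u \<in> {u. (vs ! i, u) \<in> parcs A}"
      moreover then obtain j where "j < ?n" "u = vs ! j"
        using head set by (metis in_set_conv_nth mem_Collect_eq)
      ultimately show "u \<in> (!) vs ` ?J" by blast
    qed blast
    have "inj_on ((!) vs) ?J"
      using dist by (intro inj_onI) (simp add: nth_eq_iff_index_eq)
    from card_image[OF this] have card: "card ?J = card {u. (vs ! i, u) \<in> parcs A}"
      unfolding img ..
    have "(\<Sum>j<?n. if (vs ! i, vs ! j) \<in> parcs A then 1 else 0 :: 'z) = (\<Sum>j\<in>?J. 1)"
      by (rule sum.inter_filter[symmetric]) simp
    then show ?thesis unfolding card[symmetric] by simp
  qed
  have card: "real (card {u. (v, u) \<in> parcs A}) = real ?n - 1 - real m" if v: "v \<in> pverts A" for v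
  proof -
    let ?D = "{u. (v, u) \<in> parcs A}"
    \<comment> \<open>The vertex set splits into \<open>v\<close>, its neighbours and its
      non-neighbours, so the degree is \<open>?n - 1 - m\<close>.\<close>
    have V: "pverts A = insert v (?D \<union> nonnbrs A v)"
      using v head by (auto simp: nonnbrs_def)
    have notin: "v \<notin> ?D \<union> nonnbrs A v"
      using loop by (auto simp: nonnbrs_def)
    have finD: "finite ?D"
      by (rule finite_subset[OF _ fin]) (use head in blast)
    have finN: "finite (nonnbrs A v)" using fin by (simp add: nonnbrs_def)
    have "?D \<inter> nonnbrs A v = {}" by (auto simp: nonnbrs_def)
    then have "card (?D \<union> nonnbrs A v) = card ?D + card (nonnbrs A v)"
      by (rule card_Un_disjoint[OF finD finN])
    then have "?n = Suc (card ?D + card (nonnbrs A v))"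
      unfolding n by (subst V) (use notin finD finN in simp)
    then show ?thesis using m[OF v] by simp
  qed
  have pos: "0 < ?n" using fin assms(3) n by (simp add: card_gt_0_iff)
  have entry: "adjacency_matrix A vs $$ (i, j) = (if (vs ! i, vs ! j) \<in> parcs A then 1 else 0)"
    if "i < ?n" "j < ?n" for i j
    using that by (simp add: adjacency_matrix_def)
  have vsi: "vs ! i \<in> pverts A" if "i < ?n" for i
    using nth_mem[OF that] unfolding set .
  show ?thesis unfolding n[symmetric]
  proof (rule spectral_radius_eqI[OF adjacency_matrix_carrier pos])
    show "0 \<le> real ?n - 1 - real m" using card[OF vsi[OF pos]] by linarith
  next
    fix i assume i: "i < ?n"
    have "(\<Sum>j<?n. adjacency_matrix A vs $$ (i, j)) = of_nat (card {u. (vs ! i, u) \<in> parcs A})"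
      unfolding deg[symmetric] using i by (intro sum.cong) (auto simp: entry)
    then show "(\<Sum>j<?n. adjacency_matrix A vs $$ (i, j)) = of_real (real ?n - 1 - real m)"
      unfolding card[OF vsi[OF i], symmetric] by simp
    have "(\<Sum>j<?n. norm (adjacency_matrix A vs $$ (i, j))) =
        (\<Sum>j<?n. if (vs ! i, vs ! j) \<in> parcs A then 1 else 0)"
      using i by (intro sum.cong) (auto simp: entry)
    then show "(\<Sum>j<?n. norm (adjacency_matrix A vs $$ (i, j))) = real ?n - 1 - real m"
      unfolding deg card[OF vsi[OF i]] .
  qed
qed

text \<open>The characteristic polynomial is monic, its degree is the number of vertices, and it
  splits over the complex numbers. So the size of the multiset counts the vertices and its support
  is the spectrum.\<close>

lemma adjacency_spectrum_eqD:
  assumes vs: "vertex_enum A vs" "vertex_enum B ws"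
    and eq: "adjacency_spectrum A vs = adjacency_spectrum B ws"
  shows "card (pverts A) = card (pverts B)"
    and "spectral_radius (adjacency_matrix A vs) = spectral_radius (adjacency_matrix B ws)"
proof -
  \<comment> \<open>The vertex type is left generic because the two graphs may live on different
    types.\<close>
  have size: "size (adjacency_spectrum C us) = length us"
    and spec: "spectrum (adjacency_matrix C us) = set_mset (adjacency_spectrum C us)"
    for C :: "'z pair_pre_digraph" and us
  proof -
    note deg = degree_monic_char_poly[OF adjacency_matrix_carrier[of C us]]
    then have "char_poly (adjacency_matrix C us) \<noteq> 0" by auto
    then show "spectrum (adjacency_matrix C us) = set_mset (adjacency_spectrum C us)"
      by (simp add: adjacency_spectrum_def spectrum_root_char_poly[OF adjacency_matrix_carrier])
    show "size (adjacency_spectrum C us) = length us"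
      using deg by (simp add: adjacency_spectrum_def size_proots_complex)
  qed
  show "card (pverts A) = card (pverts B)"
    using size[of A vs] size[of B ws] eq vs by (simp add: length_vertex_enum)
  show "spectral_radius (adjacency_matrix A vs) = spectral_radius (adjacency_matrix B ws)"
    using eq by (simp add: spectral_radius_def spec)
qed

section \<open>Involutions in finite 2-groups\<close>

text \<open>The fixed-point argument for 2-groups: conjugation splits \<open>T\<close> into orbits
  of two-power size, and an odd total forces an orbit of size 1, whose element is central.\<close>

lemma (in group) odd_conj_invariant_central_element:
  assumes fin: "finite (carrier G)" and ord: "Coset.order G = 2 ^ k"
    and T: "T \<subseteq> carrier G" "odd (card T)"
    and conj: "\<And>g t. g \<in> carrier G \<Longrightarrow> t \<in> T \<Longrightarrow> g \<otimes> t \<otimes> inv g \<in> T"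
  shows "\<exists>t\<in>T. \<forall>g\<in>carrier G. g \<otimes> t = t \<otimes> g"
proof (rule ccontr)
  assume neg: "\<not> ?thesis"
  define \<phi> where "\<phi> = (\<lambda>g. \<lambda>h \<in> carrier G. g \<otimes> h \<otimes> inv g)"
  interpret act: group_action G "carrier G" \<phi>
    unfolding \<phi>_def by (rule action_by_conjugation)
  have orb: "orbit G \<phi> t = (\<lambda>g. g \<otimes> t \<otimes> inv g) ` carrier G" if "t \<in> carrier G" for t
    using that by (auto simp: orbit_def \<phi>_def)
  define R where "R = {(s, t). s \<in> T \<and> t \<in> orbit G \<phi> s}"
  have sub: "orbit G \<phi> t \<subseteq> T" if "t \<in> T" for t
  proof -
    have "t \<in> carrier G" using that T(1) by blast
    from orb[OF this] show ?thesis using conj[OF _ that] by auto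
  qed
  have "equiv T R"
  proof (rule equivI)
    show "R \<subseteq> T \<times> T" using sub unfolding R_def by blast
    show "refl_on T R"
      using T(1) act.orbit_refl unfolding R_def by (intro refl_onI) blast
    show "sym R"
    proof (rule symI)
      fix s t assume "(s, t) \<in> R"
      then have "s \<in> T" "t \<in> T" "t \<in> orbit G \<phi> s" using sub unfolding R_def by blast+
      then show "(t, s) \<in> R" using T(1) act.orbit_sym[of s t] unfolding R_def by blast
    qed
    show "trans R"
    proof (rule transI)
      fix s t u assume "(s, t) \<in> R" "(t, u) \<in> R"
      then have "s \<in> T" "t \<in> T" "u \<in> T" "t \<in> orbit G \<phi> s" "u \<in> orbit G \<phi> t"
        using sub unfolding R_def by blast+
      then show "(s, u) \<in> R" using T(1) act.orbit_trans[of s t u] unfolding R_def by blast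
    qed
  qed
  moreover have "2 dvd card X" if "X \<in> T // R" for X
  proof -
    obtain t where t: "t \<in> T" "X = R `` {t}"
      using \<open>X \<in> T // R\<close> by (rule quotientE)
    then have X: "X = orbit G \<phi> t" unfolding R_def by auto
    have tG: "t \<in> carrier G" using t T(1) by blast
    have "card X * card (stabilizer G \<phi> t) = 2 ^ k"
      using act.orbit_stabilizer_theorem[OF tG] ord X by simp
    then have "card X dvd 2 ^ k" by (metis dvd_triv_left)
    then obtain j where j: "card X = 2 ^ j"
      using divides_primepow_nat[OF two_is_prime_nat] by blast
    \<comment> \<open>An orbit of size \<open>2 ^ 0\<close> would consist of a central element,
      contrary to \<open>neg\<close>.\<close>
    have "j \<noteq> 0"
    proof
      assume "j = 0"
      moreover have "t \<in> X" using act.orbit_refl[OF tG] X by simp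
      ultimately have "X = {t}" using j by (auto simp: card_1_singleton_iff)
      have "g \<otimes> t = t \<otimes> g" if g: "g \<in> carrier G" for g
      proof -
        have "g \<otimes> t \<otimes> inv g = t" using \<open>X = {t}\<close> X orb[OF tG] g by blast
        then have "g \<otimes> t \<otimes> inv g \<otimes> g = t \<otimes> g" by simp
        then show ?thesis using g tG by (simp add: m_assoc)
      qed
      then show False using neg t(1) by blast
    qed
    then show ?thesis using j by simp
  qed
  ultimately have "2 dvd card T"
    using equiv_imp_dvd_card[of T R 2] T(1) fin finite_subset by blast
  with T(2) show False by simp
qed

lemma (in group) pow_2_eq: "x \<in> carrier G \<Longrightarrow> x [^] (2::nat) = x \<otimes> x"
  by (simp add: numeral_2_eq_2)

lemma (in group) ord_eq_2_iff:
  assumes "x \<in> carrier G"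
  shows "ord x = 2 \<longleftrightarrow> x \<noteq> \<one> \<and> x \<otimes> x = \<one>"
proof -
  have "x \<otimes> x = \<one> \<longleftrightarrow> ord x dvd 2"
    using pow_eq_id[OF assms, of 2] pow_2_eq[OF assms] by simp
  moreover have "ord x dvd 2 \<longleftrightarrow> ord x = 1 \<or> ord x = 2"
    using prime_nat_iff two_is_prime_nat by (metis dvd_refl one_dvd)
  ultimately show ?thesis using ord_eq_1[OF assms] by auto
qed

section \<open>Involutions of a finite 2-group and non-adjacency in its graph\<close>

locale two_group = group +
  assumes finite_two_group: "finite_two_group G"
begin

definition invols where "invols = {x \<in> carrier G. ord x = 2}"

abbreviation "\<Gamma> \<equiv> poe_complement_graph G"

lemma fin: "finite (carrier G)" and order_two_power: "\<exists>k. Coset.order G = 2 ^ k"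
  using finite_two_group unfolding finite_two_group_def by auto

lemma mem_invols: "x \<in> invols \<longleftrightarrow> x \<in> carrier G \<and> x \<noteq> \<one> \<and> x \<otimes> x = \<one>"
  using ord_eq_2_iff unfolding invols_def by blast

lemma inv_invol: "t \<in> invols \<Longrightarrow> inv t = t"
  using mem_invols inv_equality by blast

lemma finite_invols: "finite invols"
  using fin unfolding invols_def by simp

lemma r2_eq: "r2 G = card invols"
  unfolding r2_def invols_def ..

lemma H_set_eq: "H_set G = insert \<one> invols"
  using pow_2_eq mem_invols unfolding H_set_def by auto

lemma card_H_set: "card (H_set G) = Suc (card invols)"
  using finite_invols mem_invols by (simp add: H_set_eq)

lemma ord_two_power:
  assumes "x \<in> carrier G"
  shows "\<exists>j. ord x = 2 ^ j"
proof -
  obtain k where "Coset.order G = 2 ^ k" using order_two_power by blast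
  then show ?thesis
    using ord_dvd_group_order[OF assms] divides_primepow_nat[OF two_is_prime_nat] by auto
qed

text \<open>Orders are powers of 2, so the primality condition on edges becomes a condition on
  involutions.\<close>

lemma prime_ord_iff:
  assumes "x \<in> carrier G"
  shows "prime (ord x) \<longleftrightarrow> ord x = 2"
proof -
  obtain j where "ord x = 2 ^ j" using ord_two_power[OF assms] by blast
  then show ?thesis by (metis prime_power_iff power_one_right two_is_prime_nat)
qed

text \<open>If \<open>x\<close> has order \<open>2 ^ Suc i\<close>, then \<open>x\<close> raised to
  \<open>2 ^ i\<close> is an involution.\<close>

lemma invols_nonempty:
  assumes "x \<in> carrier G" "x \<noteq> \<one>"
  shows "invols \<noteq> {}"
proof -
  obtain j where j: "ord x = 2 ^ j" using ord_two_power[OF assms(1)] by blast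
  have "j \<noteq> 0" using j assms ord_eq_1 by (metis power_0)
  then obtain i where i: "j = Suc i" using not0_implies_Suc by blast
  have "ord (x [^] ((2::nat) ^ i)) = 2 ^ Suc i div 2 ^ i"
    using ord_pow[OF assms(1), of "2 ^ i"] j i by (simp add: le_imp_power_dvd)
  then have "x [^] ((2::nat) ^ i) \<in> invols" using assms(1) by (simp add: invols_def)
  then show ?thesis by blast
qed

lemma pverts_\<Gamma>: "pverts \<Gamma> = carrier G - {\<one>}"
  by (simp add: poe_complement_graph_def)

lemma pair_graph_\<Gamma>: "pair_graph \<Gamma>"
  using fin by (intro pair_graph_poe_complement_graph group_axioms)

lemma order_eq: "Coset.order G = card (pverts \<Gamma>) + 1"
  using fin one_closed card_Suc_Diff1[of "carrier G" \<one>] unfolding pverts_\<Gamma> Coset.order_def by simp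

lemma mem_nonnbrs:
  assumes "x \<in> carrier G - {\<one>}"
  shows "y \<in> nonnbrs \<Gamma> x \<longleftrightarrow> y \<in> carrier G - {\<one>} \<and> y \<noteq> x \<and> x \<otimes> y \<in> invols"
proof -
  have "(x, y) \<in> parcs \<Gamma> \<longleftrightarrow> x \<noteq> y \<and> x \<otimes> y \<notin> invols" if "y \<in> carrier G - {\<one>}"
    using assms that prime_ord_iff[of "x \<otimes> y"]
    by (auto simp: poe_complement_graph_def invols_def)
  then show ?thesis unfolding nonnbrs_def pverts_\<Gamma> by blast
qed

text \<open>Left translation by \<open>x\<close> carries the non-neighbours injectively into the
  involutions. The values \<open>x\<close> and \<open>x \<otimes> x\<close> are missed because they
  come from \<open>\<one>\<close>, which is no vertex, and from \<open>x\<close> itself.\<close>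

lemma card_nonnbrs:
  assumes x: "x \<in> carrier G - {\<one>}"
  shows "card (nonnbrs \<Gamma> x) = card (invols - {x, x \<otimes> x})"
proof -
  have xG: "x \<in> carrier G" using x by simp
  have "(\<lambda>y. x \<otimes> y) ` nonnbrs \<Gamma> x = invols - {x, x \<otimes> x}"
  proof (intro equalityI subsetI)
    fix t assume "t \<in> (\<lambda>y. x \<otimes> y) ` nonnbrs \<Gamma> x"
    then obtain y where y: "y \<in> carrier G" "y \<noteq> \<one>" "y \<noteq> x" "x \<otimes> y \<in> invols" "t = x \<otimes> y"
      using mem_nonnbrs[OF x] by auto
    then show "t \<in> invols - {x, x \<otimes> x}" using xG by simp
  next
    fix t assume t: "t \<in> invols - {x, x \<otimes> x}"
    then have tG: "t \<in> carrier G" using mem_invols by blast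
    have eq: "x \<otimes> (inv x \<otimes> t) = t" using xG tG by (simp flip: m_assoc)
    moreover have "inv x \<otimes> t \<noteq> \<one>" "inv x \<otimes> t \<noteq> x" using eq t xG by auto
    ultimately have "inv x \<otimes> t \<in> nonnbrs \<Gamma> x"
      using mem_nonnbrs[OF x] xG tG t by auto
    with eq show "t \<in> (\<lambda>y. x \<otimes> y) ` nonnbrs \<Gamma> x" by (metis imageI)
  qed
  moreover have "inj_on (\<lambda>y. x \<otimes> y) (nonnbrs \<Gamma> x)"
    using mem_nonnbrs[OF x] xG by (intro inj_onI) (auto)
  ultimately show ?thesis using card_image by metis
qed

lemma group_exp_eq_4D:
  assumes "group_exp G = 4" "x \<in> carrier G"
  shows "x [^] (4::nat) = \<one>"
proof -
  \<comment> \<open>The group order is a positive exponent, so the \<open>LEAST\<close> in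
    \<open>group_exp\<close> is attained.\<close>
  have "0 < Coset.order G \<and> (\<forall>g\<in>carrier G. g [^] Coset.order G = \<one>)"
    using pow_order_eq_1 order_gt_0_iff_finite fin by blast
  then have "0 < group_exp G \<and> (\<forall>g\<in>carrier G. g [^] group_exp G = \<one>)"
    unfolding group_exp_def by (rule LeastI)
  then show ?thesis using assms by simp
qed


section \<open>The two implications between the isomorphism and the structure of the group\<close>

lemma inv_mem_invols: "x \<in> carrier G \<Longrightarrow> inv x \<in> invols \<longleftrightarrow> x \<in> invols"
  unfolding invols_def by simp

lemma invols_mult_commute:
  "x \<in> carrier G \<Longrightarrow> y \<in> carrier G \<Longrightarrow> x \<otimes> y \<in> invols \<longleftrightarrow> y \<otimes> x \<in> invols"
  using ord_mult_commute unfolding invols_def by auto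

text \<open>\<open>x \<otimes> y\<close> and \<open>y \<otimes> x\<close> have the same order;
  moving \<open>inv g\<close> to the front turns the conjugate back into \<open>t\<close>.\<close>

lemma conj_mem_invols:
  assumes "g \<in> carrier G" "t \<in> invols"
  shows "g \<otimes> t \<otimes> inv g \<in> invols"
proof -
  have t: "t \<in> carrier G" using assms mem_invols by blast
  have "inv g \<otimes> (g \<otimes> t) = t" using assms(1) t by (simp flip: m_assoc)
  then show ?thesis
    using invols_mult_commute[of "g \<otimes> t" "inv g"] assms t by simp
qed

text \<open>The last conclusion, regularity, is kept for the computation of the spectral
  radius.\<close>

lemma graph_iso_imp:
  assumes iso: "graph_iso \<Gamma> (X_graph h r)" and h: "2 \<le> h" "even h" and r: "1 \<le> r"
  shows "card invols = h - 1" and "Coset.order G = h * (r + 1)"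
    and "group_exp G = 4" and "subgroup (H_set G) G"
    and "\<And>x. x \<in> pverts \<Gamma> \<Longrightarrow> card (nonnbrs \<Gamma> x) = h - 2"
proof -
  obtain f where f: "bij_betw f (pverts \<Gamma>) (pverts (X_graph h r))"
    and edge: "\<And>u v. u \<in> pverts \<Gamma> \<Longrightarrow> v \<in> pverts \<Gamma> \<Longrightarrow>
      (u, v) \<in> parcs \<Gamma> \<longleftrightarrow> (f u, f v) \<in> parcs (X_graph h r)"
    using graph_isoE[OF iso] by blast
  have image: "nonnbrs (X_graph h r) (f x) = f ` nonnbrs \<Gamma> x" if "x \<in> pverts \<Gamma>" for x
    by (rule nonnbrs_image[OF f _ that]) (rule edge)
  have inj: "inj_on f (pverts \<Gamma>)" and img: "f ` pverts \<Gamma> = pverts (X_graph h r)"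
    using f by (auto simp: bij_betw_def)
  have N_sub: "nonnbrs \<Gamma> x \<subseteq> pverts \<Gamma>" for x by (auto simp: nonnbrs_def)
  show deg: "card (nonnbrs \<Gamma> x) = h - 2" if x: "x \<in> pverts \<Gamma>" for x
  proof -
    have "card (nonnbrs (X_graph h r) (f x)) = card (nonnbrs \<Gamma> x)"
      unfolding image[OF x] using inj N_sub by (intro card_image) (rule inj_on_subset)
    moreover have "f x \<in> pverts (X_graph h r)" using img x by blast
    ultimately show ?thesis using card_nonnbrs_X_graph[OF h(2)] by simp
  qed
  have card_V: "card (pverts \<Gamma>) = h - 1 + r * h"
    using bij_betw_same_card[OF f] card_pverts_X_graph[OF h(2)] by simp
  then show order: "Coset.order G = h * (r + 1)"
    using order_eq h(1) by simp
  have "pverts \<Gamma> \<noteq> {}" using card_V h(1) by (intro notI) simp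
  then obtain t where t: "t \<in> invols" using invols_nonempty pverts_\<Gamma> by blast
  have invol_vert: "t \<in> pverts \<Gamma>" if "t \<in> invols" for t
    using that mem_invols pverts_\<Gamma> by blast
  have card_N: "card (nonnbrs \<Gamma> x) = card (invols - {x, x \<otimes> x})" if "x \<in> pverts \<Gamma>" for x
    using card_nonnbrs that unfolding pverts_\<Gamma> by blast
  \<comment> \<open>The square of an involution is \<open>\<one>\<close>, so only \<open>t\<close>
    itself is removed, and counting non-neighbours of \<open>t\<close> counts the involutions. The
    positivity shown below excludes a truncated subtraction when \<open>h = 2\<close>.\<close>
  have "invols - {t, t \<otimes> t} = invols - {t}" using t mem_invols by auto
  then have "card invols - 1 = h - 2"
    using card_N[of t] deg[of t] invol_vert t finite_invols by simp
  moreover have "0 < card invols" using t finite_invols by (auto simp: card_gt_0_iff)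
  ultimately show card_T: "card invols = h - 1" using h(1) by linarith
  have pow4: "x [^] (4::nat) = \<one>" if xG: "x \<in> carrier G" for x
  proof -
    \<comment> \<open>If neither \<open>x\<close> nor its square were an involution, nothing would
      be removed and \<open>x\<close> would have \<open>h - 1\<close> non-neighbours.\<close>
    have "x = \<one> \<or> x \<in> invols \<or> x \<otimes> x \<in> invols"
    proof (rule ccontr)
      assume neg: "\<not> ?thesis"
      then have x: "x \<in> pverts \<Gamma>" using xG pverts_\<Gamma> by blast
      have "invols - {x, x \<otimes> x} = invols" using neg by blast
      then show False using card_N[OF x] deg[OF x] card_T h(1) by simp
    qed
    moreover have "x [^] (4::nat) = (x \<otimes> x) \<otimes> (x \<otimes> x)"
      using xG nat_pow_mult[of x 2 2] pow_2_eq by simp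
    ultimately show ?thesis using xG by (elim disjE) (simp_all add: mem_invols)
  qed
  \<comment> \<open>Since \<open>r\<close> is at least 1, \<open>G\<close> has more than
    \<open>h\<close> elements; an element outside \<open>H_set G\<close> has order divisible by 4
    and rules out smaller exponents.\<close>
  have "\<not> carrier G \<subseteq> H_set G"
  proof
    assume "carrier G \<subseteq> H_set G"
    then have "card (carrier G) \<le> card (H_set G)"
      using finite_invols by (intro card_mono) (simp_all add: H_set_eq)
    then have "h * (r + 1) \<le> h"
      using card_H_set card_T order h(1) unfolding Coset.order_def by linarith
    then show False using h(1) r by simp
  qed
  then obtain x where x: "x \<in> carrier G" "x \<noteq> \<one>" "x \<notin> invols"
    unfolding H_set_eq by blast
  have "4 dvd m" if "x [^] m = \<one>" for m :: nat
  proof -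
    obtain j where j: "ord x = 2 ^ j" using ord_two_power x by blast
    have "ord x \<noteq> 1" "ord x \<noteq> 2" using x ord_eq_1 unfolding invols_def by blast+
    then have "j \<noteq> 0" "j \<noteq> 1" using j by (metis power_0, metis power_one_right)
    then have "(2::nat) ^ 2 dvd 2 ^ j" by (intro le_imp_power_dvd) simp
    then have "4 dvd ord x" using j by simp
    then show ?thesis using that x pow_eq_id dvd_trans by blast
  qed
  then have "4 \<le> m" if "0 < m" "\<forall>g\<in>carrier G. g [^] m = \<one>" for m :: nat
    using that x(1) dvd_imp_le by blast
  then show "group_exp G = 4"
    unfolding group_exp_def using pow4 by (intro Least_equality) auto
  have "odd (card invols)" using card_T h by simp
  then obtain z where z: "z \<in> invols" and central: "\<And>g. g \<in> carrier G \<Longrightarrow> g \<otimes> z = z \<otimes> g"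
    using odd_conj_invariant_central_element[OF fin _ _ _ conj_mem_invols] order_two_power mem_invols
    by blast
  have zG: "z \<in> carrier G" "z \<otimes> z = \<one>" "z \<in> pverts \<Gamma>" using z invol_vert[OF z] by (simp_all add: mem_invols)
  have N: "y \<in> nonnbrs \<Gamma> x \<longleftrightarrow> y \<in> pverts \<Gamma> \<and> y \<noteq> x \<and> x \<otimes> y \<in> invols"
    if "x \<in> pverts \<Gamma>" for x y
    using mem_nonnbrs that unfolding pverts_\<Gamma> by blast
  \<comment> \<open>Centrality makes \<open>z \<otimes> t\<close> an involution for every other
    involution \<open>t\<close>; as both sets have \<open>h - 2\<close> elements, the inclusion is
    an equality.\<close>
  have N_z: "nonnbrs \<Gamma> z = invols - {z}"
  proof -
    have "invols - {z} \<subseteq> nonnbrs \<Gamma> z"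
    proof
      fix t assume "t \<in> invols - {z}"
      then have t: "t \<in> invols" "t \<noteq> z" "t \<in> carrier G" "t \<otimes> t = \<one>"
        by (simp_all add: mem_invols)
      have "(z \<otimes> t) \<otimes> (z \<otimes> t) = (z \<otimes> z) \<otimes> (t \<otimes> t)"
        using central[of t] t(3) zG(1) by (metis m_assoc m_closed)
      also have "\<dots> = \<one>" using zG(2) t(4) by simp
      finally have "(z \<otimes> t) \<otimes> (z \<otimes> t) = \<one>" .
      moreover have "z \<otimes> t \<noteq> \<one>" using t inv_equality inv_invol z zG(1) by metis
      ultimately show "t \<in> nonnbrs \<Gamma> z"
        using N[OF zG(3)] t zG(1) invol_vert[OF t(1)] by (simp add: mem_invols)
    qed
    moreover have "card (nonnbrs \<Gamma> z) = card (invols - {z})"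
      using deg[OF zG(3)] card_T z by simp
    moreover have "finite (nonnbrs \<Gamma> z)"
      using N_sub fin pverts_\<Gamma> finite_subset by (metis finite_Diff)
    ultimately show ?thesis by (metis card_subset_eq)
  qed
  have "f z \<in> pverts (X_graph h r)" using img zG(3) by blast
  \<comment> \<open>The two alternatives for the position of \<open>f z\<close> are pulled back
    along \<open>f\<close>. Products with \<open>z\<close> itself are already covered by
    \<open>N_z\<close>.\<close>
  from nonnbrs_X_graph_structure[OF this, unfolded image[OF zG(3)]]
  have prod: "s \<otimes> t \<in> invols" if st: "s \<in> invols - {z}" "t \<in> invols - {z}" "s \<noteq> t" for s t
  proof (elim disjE exE conjE)
    assume *: "\<forall>u\<in>f ` nonnbrs \<Gamma> z. nonnbrs (X_graph h r) u - {f z} = f ` nonnbrs \<Gamma> z - {u}"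
    have s: "s \<in> pverts \<Gamma>" "t \<in> pverts \<Gamma>" using st invol_vert by auto
    have "f s \<in> f ` nonnbrs \<Gamma> z" unfolding N_z using st(1) by (rule imageI)
    \<comment> \<open>Here \<open>s\<close> and \<open>z\<close> have the same non-neighbours apart
      from each other, so \<open>t\<close>, a non-neighbour of \<open>z\<close>, is one of
      \<open>s\<close>.\<close>
    with * have "f ` nonnbrs \<Gamma> s - {f z} = f ` nonnbrs \<Gamma> z - {f s}"
      unfolding image[OF s(1), symmetric] by (rule bspec)
    moreover have "f t \<in> f ` nonnbrs \<Gamma> z - {f s}"
      unfolding N_z using imageI[OF st(2)] inj_on_eq_iff[OF inj s(2,1)] st(3) by simp
    ultimately have "f t \<in> f ` nonnbrs \<Gamma> s" by blast
    then have "t \<in> nonnbrs \<Gamma> s" using inj_on_image_mem_iff[OF inj s(2) N_sub] by blast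
    then show ?thesis using N[OF s(1)] by blast
  next
    fix w' assume w': "w' \<noteq> f z" "w' \<notin> f ` nonnbrs \<Gamma> z" "w' \<in> pverts (X_graph h r)"
      and *: "\<forall>u\<in>f ` nonnbrs \<Gamma> z. w' \<in> nonnbrs (X_graph h r) u \<and>
        nonnbrs (X_graph h r) u \<subseteq> insert (f z) (insert w' (f ` nonnbrs \<Gamma> z))"
    obtain w where w: "w \<in> pverts \<Gamma>" "w' = f w" using w'(3) img by blast
    have wG: "w \<in> carrier G" "w \<noteq> \<one>" using w(1) pverts_\<Gamma> by auto
    have w_T: "w \<notin> invols" using w' w N_z by blast
    have s: "s \<in> pverts \<Gamma>" "s \<in> carrier G" using st(1) invol_vert by (simp_all add: mem_invols)
    have "f s \<in> f ` nonnbrs \<Gamma> z" unfolding N_z using st(1) by (rule imageI)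
    from bspec[OF * this] have "f w \<in> f ` nonnbrs \<Gamma> s"
      and sub: "f ` nonnbrs \<Gamma> s \<subseteq> f ` insert z (insert w (nonnbrs \<Gamma> z))"
      unfolding image[OF s(1)] w(2) image_insert by blast+
    then have "w \<in> nonnbrs \<Gamma> s" using inj_on_image_mem_iff[OF inj w(1) N_sub] by blast
    then have "s \<otimes> w \<in> invols" using N[OF s(1)] by blast
    then have "w \<otimes> s \<in> invols" using invols_mult_commute s(2) wG(1) by blast
    \<comment> \<open>As \<open>s\<close> is its own inverse, inverting \<open>w \<otimes> s\<close>
      gives \<open>s \<otimes> inv w\<close>, so \<open>inv w\<close> is a non-neighbour of
      \<open>s\<close> too.\<close>
    then have "inv (w \<otimes> s) \<in> invols" using inv_mem_invols s(2) wG(1) by simp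
    moreover have "inv (w \<otimes> s) = s \<otimes> inv w" using inv_mult_group[OF wG(1) s(2)] inv_invol st(1) by simp
    moreover have w_inv_T: "inv w \<notin> invols" using inv_mem_invols wG(1) w_T by blast
    moreover have inv_w: "inv w \<in> pverts \<Gamma>" using wG pverts_\<Gamma> by simp
    moreover have "inv w \<noteq> s" using w_inv_T st(1) by blast
    ultimately have "inv w \<in> nonnbrs \<Gamma> s" using N[OF s(1)] by simp
    then have "f (inv w) \<in> f ` insert z (insert w (nonnbrs \<Gamma> z))" using sub by blast
    moreover have "insert z (insert w (nonnbrs \<Gamma> z)) \<subseteq> pverts \<Gamma>"
      using zG(3) w(1) N_sub by blast
    ultimately have "inv w \<in> insert z (insert w (nonnbrs \<Gamma> z))"
      using inj_on_image_mem_iff[OF inj inv_w] by blast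
    \<comment> \<open>The candidates other than \<open>w\<close> are involutions, and
      \<open>inv w\<close> is not one.\<close>
    then have "inv w = w" using N_z z w_inv_T by blast
    then have "w \<otimes> w = \<one>" using r_inv[OF wG(1)] by simp
    then show ?thesis using w_T wG mem_invols by blast
  qed
  show "subgroup (H_set G) G"
  proof (rule subgroupI)
    show "H_set G \<subseteq> carrier G" "H_set G \<noteq> {}" unfolding H_set_eq using mem_invols by auto
    show "inv a \<in> H_set G" if "a \<in> H_set G" for a
      using that inv_invol unfolding H_set_eq by auto
    show "a \<otimes> b \<in> H_set G" if ab: "a \<in> H_set G" "b \<in> H_set G" for a b
    proof -
      have z_prod: "z \<otimes> t \<in> invols" if "t \<in> invols" "t \<noteq> z" for t
        using that N_z N[OF zG(3)] by blast
      \<comment> \<open>Apart from trivial products, either exactly one factor is \<open>z\<close>,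
        which \<open>N_z\<close> and centrality handle, or \<open>prod\<close> applies.\<close>
      consider "a = \<one>" | "b = \<one>" | "a = b" "a \<in> invols" | "a = z" "b \<in> invols" "b \<noteq> z"
        | "b = z" "a \<in> invols" "a \<noteq> z" | "a \<in> invols - {z}" "b \<in> invols - {z}" "a \<noteq> b"
        using ab unfolding H_set_eq by blast
      moreover have ab_carrier: "a \<in> carrier G" "b \<in> carrier G"
        using ab by (simp_all add: H_set_def)
      ultimately have "a \<otimes> b = \<one> \<or> a \<otimes> b \<in> H_set G"
      proof cases
        case 3
        then show ?thesis by (simp add: mem_invols)
      next
        case 4
        then show ?thesis using z_prod[of b] by (simp add: H_set_eq)
      next
        case 5
        then have "a \<otimes> b = z \<otimes> a" using central mem_invols by blast
        then show ?thesis using z_prod[OF 5(2,3)] by (simp add: H_set_eq)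
      next
        case 6
        then show ?thesis using prod by (simp add: H_set_eq)
      qed (use ab ab_carrier in simp_all)
      then show ?thesis by (auto simp: H_set_eq)
    qed
  qed
qed

text \<open>The recognition criterion is applied with the involutions as coclique, the right cosets
  of \<open>H_set G\<close> as classes and inversion as pairing. Exponent 4 puts all squares into
  \<open>H_set G\<close>, so \<open>x\<close> and \<open>inv x\<close> share a coset.\<close>

lemma graph_iso_if:
  assumes exp: "group_exp G = 4" and H: "subgroup (H_set G) G"
    and card_H: "card (H_set G) = h" and index: "group_index G (H_set G) = r + 1"
    and h: "2 \<le> h" "even h"
  shows "graph_iso \<Gamma> (X_graph h r)"
proof (rule graph_iso_X_graphI[where S = invols and cls = "\<lambda>x. H_set G #> x" and \<sigma> = "\<lambda>x. inv x"])
  let ?H = "H_set G"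
  interpret H: subgroup ?H G by fact
  have H_carrier: "?H \<subseteq> carrier G" by (rule H.subset)
  have sq: "x \<otimes> x \<in> ?H" if x: "x \<in> carrier G" for x
  proof -
    have "(x \<otimes> x) [^] (2::nat) = x [^] (4::nat)"
      using x nat_pow_mult[of x 2 2] pow_2_eq by simp
    then show ?thesis using group_exp_eq_4D[OF exp x] x unfolding H_set_def by simp
  qed
  have coset_eq: "?H #> x = ?H #> y \<longleftrightarrow> x \<otimes> inv y \<in> ?H" if "x \<in> carrier G" "y \<in> carrier G" for x y
    using that H coset_join1 coset_join2 coset_mult_inv1 coset_mult_inv2 H_carrier
    by (metis inv_closed m_closed)
  have coset_inv: "?H #> inv x = ?H #> x" if "x \<in> carrier G" for x
    using coset_eq[of "inv x" x] sq[of "inv x"] that by simp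
  \<comment> \<open>Replacing \<open>y\<close> by \<open>inv y\<close>, which lies in the same
    coset, turns the usual criterion for equal right cosets into one about the product.\<close>
  have prod_mem: "x \<otimes> y \<in> ?H \<longleftrightarrow> ?H #> x = ?H #> y" if "x \<in> carrier G" "y \<in> carrier G" for x y
    using coset_eq[of x "inv y"] coset_inv[of y] that by simp
  have V: "x \<in> pverts \<Gamma> - invols \<longleftrightarrow> x \<in> carrier G \<and> x \<notin> ?H" for x
    unfolding pverts_\<Gamma> H_set_eq by blast
  have N: "y \<in> nonnbrs \<Gamma> x \<longleftrightarrow> y \<in> pverts \<Gamma> \<and> y \<noteq> x \<and> y \<noteq> inv x \<and> ?H #> y = ?H #> x"
    if x: "x \<in> pverts \<Gamma>" for x y
  proof (cases "y \<in> pverts \<Gamma>")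
    case True
    then have xy: "x \<in> carrier G" "y \<in> carrier G" using x pverts_\<Gamma> by auto
    have "x \<otimes> y = \<one> \<longleftrightarrow> y = inv x"
      using xy by (metis inv_equality inv_inv r_inv)
    moreover have "\<one> \<notin> invols" using mem_invols by blast
    ultimately have "x \<otimes> y \<in> invols \<longleftrightarrow> y \<noteq> inv x \<and> ?H #> y = ?H #> x"
      using prod_mem[OF xy] unfolding H_set_eq by auto
    then show ?thesis using mem_nonnbrs[of x y] x True unfolding pverts_\<Gamma> by blast
  qed (use x mem_nonnbrs[of x y] in \<open>auto simp: pverts_\<Gamma>\<close>)
  show "pair_graph \<Gamma>" by (rule pair_graph_\<Gamma>)
  show "even h" by fact
  show "invols \<subseteq> pverts \<Gamma>" using mem_invols pverts_\<Gamma> by blast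
  show "card invols = h - 1" using card_H_set card_H by simp
  have "(r + 1) * h = Coset.order G"
    using lagrange[OF H] card_H index by simp
  then show "card (pverts \<Gamma>) = h - 1 + r * h" using order_eq h(1) by simp
  \<comment> \<open>Of the \<open>r + 1\<close> cosets only \<open>H_set G\<close> itself contains
    no vertex outside \<open>invols\<close>, which leaves \<open>r\<close> classes.\<close>
  have "(\<lambda>x. ?H #> x) ` (pverts \<Gamma> - invols) = rcosets ?H - {?H}"
  proof -
    have "?H #> x = ?H \<longleftrightarrow> x \<in> ?H" if "x \<in> carrier G" for x
      using that H coset_join1 coset_join2 H_carrier by metis
    then show ?thesis using V unfolding RCOSETS_def by auto
  qed
  moreover have "?H \<in> rcosets ?H"
    using rcosetsI[OF H_carrier one_closed] coset_mult_one[OF H_carrier] by simp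
  ultimately show "card ((\<lambda>x. ?H #> x) ` (pverts \<Gamma> - invols)) = r"
    using index by simp
  show "card {y \<in> pverts \<Gamma> - invols. ?H #> y = ?H #> x} = h" if x: "x \<in> pverts \<Gamma> - invols" for x
  proof -
    have xG: "x \<in> carrier G" "x \<notin> ?H" using x V by blast+
    have "{y \<in> pverts \<Gamma> - invols. ?H #> y = ?H #> x} = ?H #> x"
    proof (intro equalityI subsetI)
      fix y assume "y \<in> {y \<in> pverts \<Gamma> - invols. ?H #> y = ?H #> x}"
      then show "y \<in> ?H #> x" using rcos_self[OF _ H] V by blast
    next
      fix y assume y: "y \<in> ?H #> x"
      then have "?H #> y = ?H #> x" using repr_independence[OF y xG(1) H] by simp
      moreover have yG: "y \<in> carrier G" using y r_coset_subset_G[OF H_carrier xG(1)] by blast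
      moreover have "y \<notin> ?H"
      proof
        assume "y \<in> ?H"
        then have "?H #> x = ?H"
          using coset_join2[OF yG H] \<open>?H #> y = ?H #> x\<close> by simp
        then show False using coset_join1[OF _ _ H] xG by blast
      qed
      ultimately show "y \<in> {y \<in> pverts \<Gamma> - invols. ?H #> y = ?H #> x}" using V by blast
    qed
    then show ?thesis
      using card_rcosets_equal[OF rcosetsI[OF H_carrier xG(1)] H_carrier] card_H by simp
  qed
  show "inv x \<in> pverts \<Gamma> - invols \<and> inv x \<noteq> x \<and> inv (inv x) = x \<and> ?H #> inv x = ?H #> x"
    if x: "x \<in> pverts \<Gamma> - invols" for x
  proof -
    have xG: "x \<in> carrier G" "x \<notin> ?H" using x V by blast+
    have "inv x \<notin> ?H" using xG H.m_inv_closed[of "inv x"] by auto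
    moreover have "inv x \<noteq> x"
    proof
      assume "inv x = x"
      then have "x \<otimes> x = \<one>" using r_inv[OF xG(1)] by simp
      then show False using xG pow_2_eq unfolding H_set_def by simp
    qed
    ultimately show ?thesis using xG V coset_inv by simp
  qed
  show "nonnbrs \<Gamma> x = {y \<in> pverts \<Gamma> - invols. ?H #> y = ?H #> x} - {x, inv x}"
    if x: "x \<in> pverts \<Gamma> - invols" for x
  proof -
    \<comment> \<open>The whole coset of \<open>x\<close> avoids \<open>H_set G\<close>, so
      restricting it to non-involutions loses nothing.\<close>
    have "y \<notin> invols" if "?H #> y = ?H #> x" "y \<in> carrier G" for y
    proof
      assume "y \<in> invols"
      then have "?H #> x = ?H" using that coset_join2[OF _ H] H_set_eq by blast
      then show False using coset_join1[OF _ _ H] x V by blast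
    qed
    then show ?thesis using N[of x] x unfolding pverts_\<Gamma> by blast
  qed
  show "nonnbrs \<Gamma> x = invols - {x}" if x: "x \<in> invols" for x
  proof -
    have xV: "x \<in> pverts \<Gamma>" "x \<in> ?H" "x \<in> carrier G"
      using x mem_invols pverts_\<Gamma> H_set_eq by auto
    have "?H #> x = ?H" using coset_join2[OF xV(3) H xV(2)] .
    moreover have "?H #> y = ?H \<longleftrightarrow> y \<in> ?H" if "y \<in> carrier G" for y
      using that coset_join1[OF _ _ H] coset_join2[OF _ H] by blast
    ultimately show ?thesis
      using N[OF xV(1)] inv_invol[OF x] mem_invols unfolding pverts_\<Gamma> H_set_eq by auto
  qed
qed

section \<open>The equivalence, and the parameters read off from the spectrum\<close>

lemma graph_iso_iff:
  assumes h: "2 \<le> h" "even h" and r: "1 \<le> r"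
  shows "graph_iso \<Gamma> (X_graph h r) \<longleftrightarrow>
    group_exp G = 4 \<and> subgroup (H_set G) G \<and> card (H_set G) = h \<and> group_index G (H_set G) = r + 1"
proof
  assume iso: "graph_iso \<Gamma> (X_graph h r)"
  note imp = graph_iso_imp[OF iso h r]
  have card: "card (H_set G) = h" using card_H_set imp(1) h(1) by simp
  \<comment> \<open>Lagrange's theorem turns the order \<open>h * (r + 1)\<close> into the
    index.\<close>
  moreover have "group_index G (H_set G) * h = (r + 1) * h"
    using lagrange[OF imp(4)] imp(2) card by (simp only: mult.commute)
  then have "group_index G (H_set G) = r + 1" using h(1) by (subst (asm) mult_right_cancel) simp_all
  ultimately show "group_exp G = 4 \<and> subgroup (H_set G) G \<and> card (H_set G) = h \<and>
      group_index G (H_set G) = r + 1"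
    using imp by blast
qed (use graph_iso_if[OF _ _ _ _ h] in blast)

text \<open>Regularity with \<open>h - 2\<close> non-neighbours gives
  \<open>\<rho> = n - 1 - (h - 2)\<close>, hence \<open>n - \<rho> = h - 1\<close>, the number of
  involutions; with \<open>n + 1 = h * (r + 1)\<close> this becomes
  \<open>\<rho> = h * r\<close>.\<close>

lemma parameters_from_spectral_radius:
  assumes iso: "graph_iso \<Gamma> (X_graph h r)" and h: "2 \<le> h" "even h" and r: "1 \<le> r"
    and vs: "vertex_enum \<Gamma> vs"
  defines "n \<equiv> card (pverts \<Gamma>)" and "\<rho> \<equiv> spectral_radius (adjacency_matrix \<Gamma> vs)"
  shows "Coset.order G = n + 1" and "real (card (H_set G)) = real n - \<rho> + 1"
    and "real (r2 G) = real n - \<rho>"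
    and "real (group_index G (H_set G)) = 1 + \<rho> / (real n - \<rho> + 1)"
proof -
  note imp = graph_iso_imp[OF iso h r]
  have index: "group_index G (H_set G) = r + 1" using graph_iso_iff[OF h r] iso by blast
  show order: "Coset.order G = n + 1" unfolding n_def by (rule order_eq)
  then have "n \<noteq> 0" using imp(2) h r by (intro notI) simp
  then have "pverts \<Gamma> \<noteq> {}" unfolding n_def by (intro notI) simp
  then have "\<rho> = real n - 1 - real (h - 2)"
    unfolding n_def \<rho>_def using imp(5) by (intro spectral_radius_regular pair_graph_\<Gamma> vs)
  then have \<rho>: "real n - \<rho> = real h - 1" using h(1) by (simp add: of_nat_diff)
  then show r2: "real (r2 G) = real n - \<rho>" unfolding r2_eq imp(1) using h(1) by (simp add: of_nat_diff)
  show "real (card (H_set G)) = real n - \<rho> + 1"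
    using r2 card_H_set unfolding r2_eq by simp
  have "real n + 1 = real h * (real r + 1)"
    using order imp(2) by (metis of_nat_1 of_nat_add of_nat_mult)
  then have "\<rho> = real h * real r" using \<rho> by (simp add: algebra_simps)
  then show "real (group_index G (H_set G)) = 1 + \<rho> / (real n - \<rho> + 1)"
    using index \<rho> h(1) by simp
qed

end

lemma two_groupI: "finite_two_group G \<Longrightarrow> two_group G"
  unfolding two_group_def two_group_axioms_def finite_two_group_def by blast

text \<open>That the spectrum determines the invariants is expressed by comparing \<open>G\<close>
  with a second group \<open>G'\<close>, on a possibly different carrier type and with its own
  \<open>h'\<close> and \<open>r'\<close>. Equal spectra give equal numbers of vertices and equal
  spectral radii, on which alone the formulas depend.\<close>

theorem theorem5p3:
  fixes G :: "('a, 'm) monoid_scheme" and h r :: nat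
  assumes "finite_two_group G"
    and "2 \<le> h" and "even h" and "1 \<le> r"
  shows
    "(graph_iso (poe_complement_graph G) (X_graph h r) \<longleftrightarrow>
        group_exp G = 4 \<and> subgroup (H_set G) G \<and>
        card (H_set G) = h \<and> group_index G (H_set G) = r + 1)
     \<and>
     (graph_iso (poe_complement_graph G) (X_graph h r) \<longrightarrow>
        (\<forall>vs (n::nat) (\<rho>::real).
           vertex_enum (poe_complement_graph G) vs \<and>
           n = card (pverts (poe_complement_graph G)) \<and>
           \<rho> = spectral_radius (adjacency_matrix (poe_complement_graph G) vs) \<longrightarrow>
             Coset.order G = n + 1 \<and>
             real (card (H_set G)) = real n - \<rho> + 1 \<and>
             real (r2 G) = real n - \<rho> \<and>
             real (group_index G (H_set G)) = 1 + \<rho> / (real n - \<rho> + 1))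
        \<and>
        (\<forall>(G' :: ('b, 'k) monoid_scheme) h' r' vs vs'.
           finite_two_group G' \<and> 2 \<le> h' \<and> even h' \<and> 1 \<le> r' \<and>
           graph_iso (poe_complement_graph G') (X_graph h' r') \<and>
           vertex_enum (poe_complement_graph G) vs \<and>
           vertex_enum (poe_complement_graph G') vs' \<and>
           adjacency_spectrum (poe_complement_graph G) vs =
             adjacency_spectrum (poe_complement_graph G') vs' \<longrightarrow>
             Coset.order G = Coset.order G' \<and>
             r2 G = r2 G' \<and>
             card (H_set G) = card (H_set G') \<and>
             group_index G (H_set G) = group_index G' (H_set G')))"
proof -
  interpret G: two_group G by (rule two_groupI) fact
  note params = G.parameters_from_spectral_radius[OF _ assms(2-4)]
  show ?thesis
  proof (intro conjI impI allI; (elim conjE)?)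
    show "graph_iso G.\<Gamma> (X_graph h r) \<longleftrightarrow>
        group_exp G = 4 \<and> subgroup (H_set G) G \<and>
        card (H_set G) = h \<and> group_index G (H_set G) = r + 1"
      by (rule G.graph_iso_iff[OF assms(2-4)])
  next
    assume iso: "graph_iso G.\<Gamma> (X_graph h r)"
    fix vs n \<rho>
    assume vs: "vertex_enum G.\<Gamma> vs"
      and [simp]: "n = card (pverts G.\<Gamma>)" "\<rho> = spectral_radius (adjacency_matrix G.\<Gamma> vs)"
    show "Coset.order G = n + 1" "real (card (H_set G)) = real n - \<rho> + 1"
      "real (r2 G) = real n - \<rho>" "real (group_index G (H_set G)) = 1 + \<rho> / (real n - \<rho> + 1)"
      using params[OF iso vs] by simp_all
  next
    assume iso: "graph_iso G.\<Gamma> (X_graph h r)"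
    fix G' :: "('b, 'k) monoid_scheme" and h' r' vs vs'
    assume G': "finite_two_group G'" "2 \<le> h'" "even h'" "1 \<le> r'"
        "graph_iso (poe_complement_graph G') (X_graph h' r')"
      and vs: "vertex_enum G.\<Gamma> vs" and vs': "vertex_enum (poe_complement_graph G') vs'"
      and spec: "adjacency_spectrum G.\<Gamma> vs = adjacency_spectrum (poe_complement_graph G') vs'"
    interpret G': two_group G' by (rule two_groupI) fact
    \<comment> \<open>\<open>params\<close> now lists the four formulas for \<open>G\<close> and
      then the four for \<open>G'\<close>; those over the reals descend to
      \<open>nat\<close>.\<close>
    note params = params[OF iso vs] G'.parameters_from_spectral_radius[OF G'(5,2,3,4) vs']
    note eq = adjacency_spectrum_eqD[OF vs vs' spec]
    show "Coset.order G = Coset.order G'" using params(1,5) eq by simp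
    have "real (r2 G) = real (r2 G')" using params(3,7) eq by simp
    then show "r2 G = r2 G'" by simp
    have "real (card (H_set G)) = real (card (H_set G'))" using params(2,6) eq by simp
    then show "card (H_set G) = card (H_set G')" by simp
    have "real (group_index G (H_set G)) = real (group_index G' (H_set G'))"
      using params(4,8) eq by simp
    then show "group_index G (H_set G) = group_index G' (H_set G')" by simp
  qed
qed

end
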